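(* Let $A$ be a compact metric space without isolated points and $f:A\to A$ a homeomorphism such that the cascade $(A,f)$ is minimal. Let $X$ be a complete metric space without isolated points and $T:X\to X$ a homeomorphism. Let $\tilde h:A\to\mathbb{Z}$ be continuous and let $h:\mathbb{Z}\times A\to\mathbb{Z}$ be the cocycle given by $h(n,a)=\sum_{k=0}^{n-1}\tilde h(f^k(a))$ for $n\ge1$, $h(0,a)=0$, and $h(n,a)=-\sum_{k=1}^{-n}\tilde h(f^{-k}(a))$ for $n<0$, giving the skew product $(A\times X,F)$ with $F(a,x)=(f(a),T^{h(1,a)}x)$ for every $(a,x)\in A\times X$. Assume further that (1) $(X,T)$ is weakly mixing, and (2) there exists $a\in A$ for which the set $\{h(n,a):n\in\mathbb{Z}\}$ is unbounded. Then the skew product cascade $(A\times X,F)$ is topologically transitive.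
   Context: A cascade $(Y,S)$ is a space $Y$ with a homeomorphism $S:Y\to Y$. It is minimal if every orbit $\{S^n y:n\in\mathbb{Z}\}$ is dense in $Y$. It is topologically transitive if for all nonempty open $U,V\subset Y$ there is $n\in\mathbb{N}$ (positive integer) with $S^n(U)\cap V\neq\emptyset$. It is weakly mixing if $(Y\times Y,S\times S)$ is topologically transitive. $\mathbb{Z}$ carries the discrete topology. *)

theory Defs
  imports "HOL-Analysis.Analysis"
begin

text \<open>
  Spaces are types of a topological or metric type class, so a cascade is given by its
  homeomorphism alone. The empty space, which no type represents, is immaterial here.
\<close>

definition cascade :: "('y::topological_space \<Rightarrow> 'y) \<Rightarrow> bool" where
  "cascade S \<longleftrightarrow> (\<exists>S'. homeomorphism UNIV UNIV S S')"

text \<open>The integer power \<open>S\<^sup>n\<close>; only meaningful for a bijection \<open>S\<close>.\<close>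

definition int_iterate :: "('y \<Rightarrow> 'y) \<Rightarrow> int \<Rightarrow> 'y \<Rightarrow> 'y" where
  "int_iterate S n = (if n \<ge> 0 then S ^^ nat n else inv S ^^ nat (- n))"

definition minimal_cascade :: "('y::topological_space \<Rightarrow> 'y) \<Rightarrow> bool" where
  "minimal_cascade S \<longleftrightarrow> cascade S \<and> (\<forall>y. closure {int_iterate S n y | n. True} = UNIV)"

definition topologically_transitive :: "('y::topological_space \<Rightarrow> 'y) \<Rightarrow> bool" where
  "topologically_transitive S \<longleftrightarrow>
    (\<forall>U V. open U \<and> U \<noteq> {} \<and> open V \<and> V \<noteq> {} \<longrightarrow> (\<exists>n::nat. n > 0 \<and> (S ^^ n) ` U \<inter> V \<noteq> {}))"

definition weakly_mixing :: "('y::topological_space \<Rightarrow> 'y) \<Rightarrow> bool" where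
  "weakly_mixing S \<longleftrightarrow> topologically_transitive (map_prod S S)"

definition cocycle :: "('a \<Rightarrow> 'a) \<Rightarrow> ('a \<Rightarrow> int) \<Rightarrow> int \<Rightarrow> 'a \<Rightarrow> int" where
  "cocycle f ht n a =
    (if n \<ge> 1 then \<Sum>k = 0..n - 1. ht (int_iterate f k a)
     else if n = 0 then 0
     else - (\<Sum>k = 1..- n. ht (int_iterate f (- k) a)))"

definition skew_product ::
    "('a \<Rightarrow> 'a) \<Rightarrow> ('x \<Rightarrow> 'x) \<Rightarrow> (int \<Rightarrow> 'a \<Rightarrow> int) \<Rightarrow> 'a \<times> 'x \<Rightarrow> 'a \<times> 'x" where
  "skew_product f T h = (\<lambda>(a, x). (f a, int_iterate T (h 1 a) x))"

end

theory Submission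
  imports Defs
begin

text \<open>
  Write \<open>s n a\<close> for the Birkhoff sum \<open>h(n,a)\<close> with \<open>n \<ge> 0\<close>. If the forward sums along a single orbit
  were bounded, then, as in the Gottschalk--Hedlund theorem, density of that forward orbit would make
  all sums uniformly bounded, contradicting (2). So at every point the forward sums are unbounded;
  since \<open>ht\<close> is bounded they advance by bounded steps, and since return times to an open
  set are bounded by compactness, the sums at return times meet every long enough interval of
  positive integers (or every long enough interval of negative ones). By Furstenberg's intersection
  lemma, weak mixing of \<open>T\<close> makes the transfer times between two open sets contain arbitrarily long
  intervals of both signs, so the two sets of integers meet.
\<close>

section \<open>Birkhoff sums and the cocycle\<close>

definition birkhoff_sum :: "('a \<Rightarrow> 'a) \<Rightarrow> ('a \<Rightarrow> int) \<Rightarrow> nat \<Rightarrow> 'a \<Rightarrow> int" where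
  "birkhoff_sum f g n a = (\<Sum>k<n. g ((f ^^ k) a))"

lemma birkhoff_sum_0 [simp]: "birkhoff_sum f g 0 a = 0"
  by (simp add: birkhoff_sum_def)

lemma birkhoff_sum_Suc: "birkhoff_sum f g (Suc n) a = birkhoff_sum f g n a + g ((f ^^ n) a)"
  by (simp add: birkhoff_sum_def)

text \<open>The cocycle identity at nonnegative times: it turns a difference of two sums at
  \<open>a\<close> into a sum at a later point of its orbit.\<close>

lemma birkhoff_sum_add:
  "birkhoff_sum f g (m + n) a = birkhoff_sum f g m a + birkhoff_sum f g n ((f ^^ m) a)"
proof (induction n)
  case (Suc n)
  have "(f ^^ (m + n)) a = (f ^^ n) ((f ^^ m) a)"
    by (metis add.commute comp_apply funpow_add)
  with Suc show ?case by (simp add: birkhoff_sum_Suc)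
qed simp

lemma cocycle_1 [simp]: "cocycle f g 1 a = g a"
  by (simp add: cocycle_def int_iterate_def)

lemma cocycle_of_nat: "cocycle f g (int n) a = birkhoff_sum f g n a"
proof (cases n)
  case (Suc m)
  have "(\<Sum>k = 0..int n - 1. g (int_iterate f k a)) = (\<Sum>k<n. g ((f ^^ k) a))"
    by (rule sum.reindex_bij_witness[of _ int nat]) (auto simp: int_iterate_def)
  with Suc show ?thesis by (simp add: cocycle_def birkhoff_sum_def)
qed (simp add: cocycle_def)

lemma funpow_inv_cancel:
  assumes "bij f"
  shows "(f ^^ n) ((inv f ^^ n) a) = a" "(inv f ^^ n) ((f ^^ n) a) = a"
  using assms by (metis bij_fn bij_inv_eq_iff inv_fn)+

text \<open>The \<open>n\<close> points preceding \<open>a\<close> are the first \<open>n\<close>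
  points of the forward orbit of its \<open>n\<close>-th preimage, read backwards; hence the
  reindexing by \<open>n - k\<close>.\<close>

lemma cocycle_uminus_of_nat:
  assumes "bij f"
  shows "cocycle f g (- int n) a = - birkhoff_sum f g n ((inv f ^^ n) a)"
proof (cases n)
  case (Suc m)
  have *: "(f ^^ k) ((inv f ^^ n) a) = (inv f ^^ (n - k)) a" if "k < n" for k
  proof -
    have "(inv f ^^ n) a = (inv f ^^ k) ((inv f ^^ (n - k)) a)"
      using that by (metis comp_apply funpow_add le_add_diff_inverse less_imp_le)
    then show ?thesis by (simp add: funpow_inv_cancel[OF assms])
  qed
  have "(\<Sum>k = 1..int n. g (int_iterate f (- k) a))
      = (\<Sum>k<n. g ((f ^^ k) ((inv f ^^ n) a)))"
    by (rule sum.reindex_bij_witness[of _ "\<lambda>k. int (n - k)" "\<lambda>k. n - nat k"])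
       (auto simp: int_iterate_def * )
  with Suc show ?thesis
    by (simp add: cocycle_def birkhoff_sum_def add.commute[of _ 1] del: sum.lessThan_Suc funpow.simps)
qed (simp add: cocycle_def)

section \<open>Integer powers of a homeomorphism\<close>

lemma cascade_bij: "cascade S \<Longrightarrow> bij S"
  unfolding cascade_def homeomorphism_def by (metis UNIV_I bijI')

lemma cascade_continuous: "cascade S \<Longrightarrow> continuous_on UNIV S"
  unfolding cascade_def homeomorphism_def by blast

lemma cascade_inv_continuous:
  assumes "cascade S"
  shows "continuous_on UNIV (inv S)"
proof -
  obtain S' where S': "homeomorphism UNIV UNIV S S'"
    using assms cascade_def by blast
  then have "inv S = S'"
    by (intro inv_equality) (auto simp: homeomorphism_def)
  with S' show ?thesis by (simp add: homeomorphism_def)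
qed

lemma continuous_on_funpow:
  fixes S :: "'a::topological_space \<Rightarrow> 'a"
  assumes "continuous_on UNIV S"
  shows "continuous_on UNIV (S ^^ n)"
proof (induction n)
  case (Suc n)
  then show ?case
    using continuous_on_compose2[OF assms, of UNIV "S ^^ n"] by (simp add: comp_def)
qed (simp add: id_def)

lemma continuous_on_birkhoff_sum:
  fixes f :: "'a::topological_space \<Rightarrow> 'a"
  assumes "continuous_on UNIV f" "continuous_on UNIV g"
  shows "continuous_on UNIV (birkhoff_sum f g n)"
proof -
  have "continuous_on UNIV (\<lambda>a. g ((f ^^ k) a))" for k
    using continuous_on_compose2[OF assms(2) continuous_on_funpow[OF assms(1)]] by simp
  then show ?thesis
    unfolding birkhoff_sum_def by (intro continuous_on_sum)
qed

lemma int_iterate_continuous: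
  assumes "cascade S"
  shows "continuous_on UNIV (int_iterate S n)"
  using assms
  by (simp add: int_iterate_def continuous_on_funpow cascade_continuous cascade_inv_continuous)

text \<open>The bound on \<open>n\<close> keeps the total exponent nonnegative, so
  \<open>nat\<close> does not truncate it.\<close>

lemma int_iterate_funpow_add:
  assumes "bij S" and "- int m \<le> n"
  shows "int_iterate S n ((S ^^ m) y) = (S ^^ nat (n + int m)) y"
proof (cases "n \<ge> 0")
  case True
  then have "nat (n + int m) = nat n + m" by simp
  with True show ?thesis by (simp add: int_iterate_def funpow_add)
next
  case False
  with assms(2) have "m = nat (- n) + nat (n + int m)" by simp
  then have "(S ^^ m) y = (S ^^ nat (- n)) ((S ^^ nat (n + int m)) y)"
    by (metis comp_apply funpow_add)
  with False show ?thesis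
    by (simp add: int_iterate_def funpow_inv_cancel[OF assms(1)])
qed

lemma int_iterate_add:
  assumes "bij S"
  shows "int_iterate S k (int_iterate S l x) = int_iterate S (k + l) x"
proof -
  \<comment> \<open>With \<open>x = (S ^^ m) y\<close> for this \<open>m\<close>, both
    \<open>l + m\<close> and \<open>k + l + m\<close> are nonnegative, so no case distinction on
    signs is needed.\<close>
  define m where "m = nat (\<bar>k\<bar> + \<bar>l\<bar>)"
  obtain y where x: "x = (S ^^ m) y"
    using funpow_inv_cancel(1)[OF assms] by metis
  have "int_iterate S l x = (S ^^ nat (l + int m)) y"
    unfolding x by (rule int_iterate_funpow_add[OF assms]) (simp add: m_def)
  moreover have nat: "int (nat (l + int m)) = l + int m" by (simp add: m_def)
  moreover have "int_iterate S k ((S ^^ nat (l + int m)) y)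
      = (S ^^ nat (k + int (nat (l + int m)))) y"
    by (rule int_iterate_funpow_add[OF assms], unfold nat) (simp add: m_def)
  moreover have "int_iterate S (k + l) x = (S ^^ nat (k + l + int m)) y"
    unfolding x by (rule int_iterate_funpow_add[OF assms]) (simp add: m_def)
  ultimately show ?thesis by (simp add: algebra_simps)
qed

text \<open>Integer powers of \<open>T\<close> compose additively, so the fibre exponents met along
  the base orbit add up to the Birkhoff sum.\<close>

lemma skew_product_funpow:
  assumes "bij T"
  shows "(skew_product f T (cocycle f g) ^^ n) (a, x)
    = ((f ^^ n) a, int_iterate T (birkhoff_sum f g n a) x)"
proof (induction n)
  case (Suc n)
  then show ?case
    by (simp add: skew_product_def int_iterate_add[OF assms] birkhoff_sum_Suc add.commute)
qed (simp add: int_iterate_def)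

section \<open>Minimality: return times and growth of Birkhoff sums\<close>

lemma minimal_bounded_return_time:
  fixes f :: "'a::topological_space \<Rightarrow> 'a"
  assumes "compact (UNIV :: 'a set)" and "minimal_cascade f" and "open V" "V \<noteq> {}"
  obtains N where "\<And>a. \<exists>i\<le>N. (f ^^ i) a \<in> V"
proof -
  have f: "cascade f" and dense: "\<And>y. closure {int_iterate f n y | n. True} = UNIV"
    using assms(2) by (auto simp: minimal_cascade_def)
  \<comment> \<open>Every full orbit is dense, so these open preimages cover the space; compactness
    leaves finitely many exponents.\<close>
  have "open (int_iterate f n -` V)" for n
    using int_iterate_continuous[OF f] assms(3) by (simp add: continuous_on_open_vimage)
  moreover have "UNIV \<subseteq> (\<Union>n\<in>UNIV. int_iterate f n -` V)"
  proof
    fix y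
    have "V \<inter> {int_iterate f n y | n. True} \<noteq> {}"
      using open_Int_closure_eq_empty[OF assms(3), of "{int_iterate f n y | n. True}"]
        dense[of y] assms(4) by simp
    then show "y \<in> (\<Union>n\<in>UNIV. int_iterate f n -` V)" by auto
  qed
  ultimately obtain C where C: "finite C" "UNIV \<subseteq> (\<Union>n\<in>C. int_iterate f n -` V)"
    using assms(1) compactE_image[of UNIV UNIV "\<lambda>n. int_iterate f n -` V"] by metis
  define N where "N = Max (insert 0 ((\<lambda>n. nat \<bar>n\<bar>) ` C))"
  have N: "\<bar>n\<bar> \<le> int N" if "n \<in> C" for n
    using Max_ge[of "insert 0 ((\<lambda>n. nat \<bar>n\<bar>) ` C)" "nat \<bar>n\<bar>"] C(1) that
    unfolding N_def[symmetric] by auto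
  \<comment> \<open>The cover is used at \<open>(f ^^ N) a\<close>: an exponent \<open>n\<close>
    with \<open>\<bar>n\<bar> \<le> N\<close> there becomes \<open>n + N\<close>, between 0 and
    \<open>2 * N\<close>, at \<open>a\<close>.\<close>
  have "\<exists>i\<le>2 * N. (f ^^ i) a \<in> V" for a
  proof -
    obtain n where n: "n \<in> C" "int_iterate f n ((f ^^ N) a) \<in> V"
      using C(2) by blast
    have "(f ^^ nat (n + int N)) a \<in> V"
      using n N[OF n(1)] int_iterate_funpow_add[OF cascade_bij[OF f], of N n a] by simp
    moreover have "nat (n + int N) \<le> 2 * N" using N[OF n(1)] by simp
    ultimately show ?thesis by blast
  qed
  then show ?thesis using that by blast
qed

lemma birkhoff_sum_unbounded:
  fixes f :: "'a::topological_space \<Rightarrow> 'a"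
  assumes "compact (UNIV :: 'a set)" and "minimal_cascade f" and "continuous_on UNIV g"
    and unbounded: "\<not> bounded {real_of_int (cocycle f g n b) | n. True}"
  shows "\<exists>n. \<bar>birkhoff_sum f g n a\<bar> > M"
proof (rule ccontr)
  assume "\<not> ?thesis"
  then have M: "\<bar>birkhoff_sum f g n a\<bar> \<le> M" for n
    by (meson not_le)
  have f: "cascade f" using assms(2) by (simp add: minimal_cascade_def)
  \<comment> \<open>The forward orbit of \<open>a\<close> would enter the open set of points
    violating the bound, yet a sum started on that orbit is a difference of two sums at
    \<open>a\<close>.\<close>
  have bound: "\<bar>birkhoff_sum f g n c\<bar> \<le> 2 * M" for n c
  proof (rule ccontr)
    define V where "V = birkhoff_sum f g n -` {z. \<bar>z\<bar> > 2 * M}"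
    assume "\<not> ?thesis"
    then have "V \<noteq> {}" by (auto simp: V_def not_le)
    moreover have "open V"
      unfolding V_def
      using continuous_on_birkhoff_sum[OF cascade_continuous[OF f] assms(3)] open_discrete
      by (metis continuous_on_open_vimage open_UNIV Int_UNIV_right)
    ultimately obtain i where "(f ^^ i) a \<in> V"
      using minimal_bounded_return_time[OF assms(1,2)] by metis
    then have "\<bar>birkhoff_sum f g (i + n) a - birkhoff_sum f g i a\<bar> > 2 * M"
      by (simp add: V_def birkhoff_sum_add)
    with M[of "i + n"] M[of i] show False by linarith
  qed
  \<comment> \<open>At negative times the cocycle is minus a forward sum started at a preimage of
    \<open>b\<close>; the bound covers it, being uniform in the starting point.\<close>
  have "\<bar>cocycle f g n b\<bar> \<le> 2 * M" for n
  proof (cases "n \<ge> 0")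
    case True
    then show ?thesis using bound cocycle_of_nat[of f g "nat n" b] by simp
  next
    case False
    then show ?thesis
      using bound cocycle_uminus_of_nat[OF cascade_bij[OF f], of g "nat (- n)" b] by simp
  qed
  then have "\<bar>real_of_int (cocycle f g n b)\<bar> \<le> real_of_int (2 * M)" for n
    by (metis of_int_abs of_int_le_iff)
  then have "bounded {real_of_int (cocycle f g n b) | n. True}"
    unfolding bounded_iff by (intro exI[of _ "real_of_int (2 * M)"]) auto
  with unbounded show False by blast
qed

section \<open>Weak mixing and long intervals of integers\<close>

lemma transitive_pair_funpow:
  fixes T :: "'x::topological_space \<Rightarrow> 'x"
  assumes "weakly_mixing T"
    and "open U1" "U1 \<noteq> {}" "open V1" "V1 \<noteq> {}" "open U2" "U2 \<noteq> {}" "open V2" "V2 \<noteq> {}"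
  obtains n x y where "n > 0" "x \<in> U1" "(T ^^ n) x \<in> V1" "y \<in> U2" "(T ^^ n) y \<in> V2"
proof -
  have "(map_prod T T ^^ n) (x, y) = ((T ^^ n) x, (T ^^ n) y)" for n x y
    by (induction n) auto
  moreover have "\<exists>n>0. (map_prod T T ^^ n) ` (U1 \<times> U2) \<inter> (V1 \<times> V2) \<noteq> {}"
    using assms open_Times[of U1 U2] open_Times[of V1 V2]
    unfolding weakly_mixing_def topologically_transitive_def by simp
  ultimately show ?thesis using that by fastforce
qed

text \<open>Furstenberg's intersection lemma, iterated over the pairs \<open>(U, T\<^sup>-\<^sup>j V)\<close> with \<open>j \<le> M\<close>.\<close>

lemma weakly_mixing_subpair:
  fixes T :: "'x::topological_space \<Rightarrow> 'x"
  assumes "weakly_mixing T" and T: "continuous_on UNIV T" "surj T"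
    and "open U" "U \<noteq> {}" "open V" "V \<noteq> {}"
  shows "\<exists>U' V'. open U' \<and> U' \<noteq> {} \<and> open V' \<and> V' \<noteq> {} \<and>
    (\<forall>m. \<forall>x\<in>U'. (T ^^ m) x \<in> V' \<longrightarrow> (\<forall>j\<le>M. \<exists>y\<in>U. (T ^^ (m + j)) y \<in> V))"
proof (induction M)
  case 0
  show ?case using assms by auto
next
  case (Suc M)
  then obtain U' V' where UV': "open U'" "U' \<noteq> {}" "open V'" "V' \<noteq> {}"
    and sub: "\<And>m x j. \<lbrakk>x \<in> U'; (T ^^ m) x \<in> V'; j \<le> M\<rbrakk> \<Longrightarrow> \<exists>y\<in>U. (T ^^ (m + j)) y \<in> V"
    by metis
  have open_vimage_funpow: "open ((T ^^ n) -` W)" if "open W" for n W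
    using continuous_on_funpow[OF T(1)] that by (simp add: continuous_on_open_vimage)
  define W where "W = (T ^^ Suc M) -` V"
  have W: "open W" "W \<noteq> {}"
    unfolding W_def using open_vimage_funpow[OF \<open>open V\<close>] \<open>V \<noteq> {}\<close>
    by (simp_all only: surj_vimage_empty[OF surj_fn[OF T(2)]] not_False_eq_True)
  \<comment> \<open>One time \<open>n\<close> carries part of \<open>U'\<close> into
    \<open>U\<close> and part of \<open>V'\<close> into \<open>W\<close>; shrinking to these parts
    adds the delay \<open>Suc M\<close> and keeps the earlier ones.\<close>
  obtain n p q where n: "p \<in> U'" "(T ^^ n) p \<in> U" "q \<in> V'" "(T ^^ n) q \<in> W"
    using transitive_pair_funpow[OF assms(1) UV'(1,2) assms(4,5) UV'(3,4) W] by metis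
  let ?U = "U' \<inter> (T ^^ n) -` U" and ?V = "V' \<inter> (T ^^ n) -` W"
  have "\<exists>y\<in>U. (T ^^ (m + j)) y \<in> V" if x: "x \<in> ?U" "(T ^^ m) x \<in> ?V" and j: "j \<le> Suc M"
    for m x j
  proof (cases "j \<le> M")
    case True
    then show ?thesis using sub x by auto
  next
    case False
    with j have j: "j = Suc M" by simp
    \<comment> \<open>For the new delay the witness is \<open>(T ^^ n) x\<close> instead of
      \<open>x\<close>; commuting the powers uses that \<open>(T ^^ n) ((T ^^ m) x)\<close> lies in
      \<open>W\<close>.\<close>
    have "(T ^^ (m + j)) ((T ^^ n) x) = (T ^^ (m + j + n)) x"
      by (simp only: funpow_add comp_apply)
    also have "m + j + n = j + (n + m)" by simp
    also have "(T ^^ (j + (n + m))) x = (T ^^ j) ((T ^^ n) ((T ^^ m) x))"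
      by (simp only: funpow_add comp_apply)
    also have "\<dots> \<in> V" using x(2) by (simp add: j W_def)
    finally show ?thesis using x(1) by auto
  qed
  moreover have "open ?U" "open ?V"
    using UV' W open_vimage_funpow assms(4) by auto
  moreover have "?U \<noteq> {}" "?V \<noteq> {}" using n by auto
  ultimately show ?case
    by (intro exI[of _ ?U] exI[of _ ?V] conjI allI ballI impI)
qed

text \<open>A single transfer time \<open>m\<close> from \<open>U'\<close> to \<open>V'\<close>
  yields the whole interval from \<open>m\<close> to \<open>m + M\<close> for \<open>U\<close> and
  \<open>V\<close>.\<close>

lemma weakly_mixing_thick:
  fixes T :: "'x::topological_space \<Rightarrow> 'x"
  assumes "weakly_mixing T" "continuous_on UNIV T" "surj T"
    and "open U" "U \<noteq> {}" "open V" "V \<noteq> {}"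
  obtains m where "\<And>j. j \<le> M \<Longrightarrow> \<exists>x\<in>U. (T ^^ (m + j)) x \<in> V"
proof -
  obtain U' V' where UV: "open U'" "U' \<noteq> {}" "open V'" "V' \<noteq> {}"
    "\<And>m x j. \<lbrakk>x \<in> U'; (T ^^ m) x \<in> V'; j \<le> M\<rbrakk> \<Longrightarrow> \<exists>y\<in>U. (T ^^ (m + j)) y \<in> V"
    using weakly_mixing_subpair[OF assms] by metis
  obtain n x where "x \<in> U'" "(T ^^ n) x \<in> V'"
    using transitive_pair_funpow[OF assms(1) UV(1-4) UV(1-4)] by metis
  then show ?thesis using UV(5) that by blast
qed

text \<open>The first passage above a level overshoots it by at most \<open>C\<close>, and waiting
  at most \<open>N\<close> more steps to enter \<open>R\<close> moves \<open>s\<close> by at most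
  \<open>N * C\<close>. The resulting window has a width independent of \<open>m\<close>.\<close>

lemma bounded_steps_meet_intervals:
  fixes s :: "nat \<Rightarrow> int"
  assumes "s 0 = 0" and step: "\<And>n. \<bar>s (Suc n) - s n\<bar> \<le> C"
    and unbounded: "\<And>k. \<exists>n. s n \<ge> k"
    and R: "\<And>n. \<exists>i\<in>{1..N}. n + i \<in> R"
  shows "\<exists>M. \<forall>m::nat. \<exists>n\<in>R. n > 0 \<and> (\<exists>j\<le>M. s n = int (m + j))"
proof -
  have C: "C \<ge> 0" using step[of 0] by linarith
  define L where "L = int N * C"
  have L: "L \<ge> 0" using C by (simp add: L_def)
  have steps: "\<bar>s (n + i) - s n\<bar> \<le> int i * C" for n i
  proof (induction i)
    case (Suc i)
    then show ?case using step[of "n + i"] by (simp add: algebra_simps)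
  qed simp
  have "\<exists>n\<in>R. n > 0 \<and> (\<exists>j\<le>nat (C + 2 * L). s n = int (m + j))" for m :: nat
  proof -
    \<comment> \<open>The level is raised by \<open>L\<close> so that a later drop of at most
      \<open>L\<close> still leaves \<open>s\<close> at or above \<open>m\<close>.\<close>
    define k where "k = int m + L"
    define n where "n = (LEAST n. s n \<ge> k)"
    have n: "s n \<ge> k" unfolding n_def using unbounded[of k] by (rule LeastI_ex)
    have nC: "s n \<le> k + C"
    proof (cases n)
      case 0
      then show ?thesis using assms(1) C L by (simp add: k_def)
    next
      case (Suc n')
      then have "\<not> s n' \<ge> k" using not_less_Least[of n' "\<lambda>n. s n \<ge> k"] n_def by simp
      then show ?thesis using step[of n'] Suc by simp
    qed
    obtain i where i: "i \<in> {1..N}" "n + i \<in> R" using R by blast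
    have "\<bar>s (n + i) - s n\<bar> \<le> L"
      using steps[of n i] mult_right_mono[of "int i" "int N" C] i C by (simp add: L_def)
    then have "s (n + i) \<ge> int m" "s (n + i) \<le> int m + (C + 2 * L)"
      using n nC by (auto simp: k_def)
    then have "s (n + i) = int (m + nat (s (n + i) - int m))"
      "nat (s (n + i) - int m) \<le> nat (C + 2 * L)" by auto
    then show ?thesis using i by (intro bexI[of _ "n + i"]) auto
  qed
  then show ?thesis by blast
qed

section \<open>Transitivity of the skew product\<close>

lemma open_prod_subrectangle:
  assumes "open W" "W \<noteq> {}"
  obtains A B where "open A" "A \<noteq> {}" "open B" "B \<noteq> {}" "A \<times> B \<subseteq> W"
proof -
  obtain w where w: "w \<in> W" using assms(2) by blast
  obtain A B where "open A" "open B" "w \<in> A \<times> B" "A \<times> B \<subseteq> W"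
    using open_prod_elim[OF assms(1) w] .
  moreover from this have "A \<noteq> {}" "B \<noteq> {}" by auto
  ultimately show ?thesis using that by blast
qed

text \<open>The fibres of \<open>g\<close> are open because the integers are discrete, so by
  compactness finitely many values occur.\<close>

lemma discrete_valued_bounded:
  fixes g :: "'a::topological_space \<Rightarrow> int"
  assumes "compact (UNIV :: 'a set)" "continuous_on UNIV g"
  obtains C where "\<And>a. \<bar>g a\<bar> \<le> C"
proof -
  have "open (g -` {c})" for c
    using assms(2) open_discrete by (metis continuous_on_open_vimage open_UNIV Int_UNIV_right)
  moreover have "UNIV \<subseteq> (\<Union>c\<in>UNIV. g -` {c})" by auto
  ultimately obtain D where D: "finite D" "UNIV \<subseteq> (\<Union>c\<in>D. g -` {c})"
    using assms(1) compactE_image[of UNIV UNIV "\<lambda>c. g -` {c}"] by metis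
  then have "\<bar>g a\<bar> \<le> Max (abs ` D)" for a
    by (intro Max_ge) auto
  then show ?thesis using that by blast
qed

theorem theorem3p13:
  fixes f :: "'a::{metric_space, perfect_space} \<Rightarrow> 'a"
    and T :: "'x::{complete_space, perfect_space} \<Rightarrow> 'x"
    and ht :: "'a \<Rightarrow> int"
  assumes "compact (UNIV :: 'a set)"
    and "minimal_cascade f"
    and "cascade T"
    and "continuous_on UNIV ht"
    and "weakly_mixing T"
    and "\<exists>a. \<not> bounded {real_of_int (cocycle f ht n a) | n. True}"
  shows "topologically_transitive (skew_product f T (cocycle f ht))"
  unfolding topologically_transitive_def
proof (intro allI impI, elim conjE)
  fix U V :: "('a \<times> 'x) set"
  assume "open U" "U \<noteq> {}" "open V" "V \<noteq> {}"
  obtain U1 U2 where U: "open U1" "U1 \<noteq> {}" "open U2" "U2 \<noteq> {}" "U1 \<times> U2 \<subseteq> U"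
    using open_prod_subrectangle[OF \<open>open U\<close> \<open>U \<noteq> {}\<close>] .
  obtain V1 V2 where V: "open V1" "V1 \<noteq> {}" "open V2" "V2 \<noteq> {}" "V1 \<times> V2 \<subseteq> V"
    using open_prod_subrectangle[OF \<open>open V\<close> \<open>V \<noteq> {}\<close>] .
  \<comment> \<open>The base point stays fixed from here on; only the fibre point is still to be
    chosen.\<close>
  obtain a where a: "a \<in> U1" using U(2) by blast
  define s where "s n = birkhoff_sum f ht n a" for n
  define R where "R = {n. (f ^^ n) a \<in> V1}"
  have T: "bij T" "continuous_on UNIV T" "surj T"
    using cascade_bij[OF assms(3)] cascade_continuous[OF assms(3)] by (auto dest: bij_is_surj)
  obtain C where "\<And>b. \<bar>ht b\<bar> \<le> C"
    using discrete_valued_bounded[OF assms(1,4)] by blast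
  then have step: "\<bar>s (Suc n) - s n\<bar> \<le> C" "\<bar>- s (Suc n) - - s n\<bar> \<le> C" for n
    by (simp_all add: s_def birkhoff_sum_Suc)
  obtain N where N: "\<And>b. \<exists>i\<le>N. (f ^^ i) b \<in> V1"
    using minimal_bounded_return_time[OF assms(1,2) V(1,2)] by blast
  \<comment> \<open>The return bound is applied at \<open>(f ^^ Suc n) a\<close>, one step ahead, so
    that the waiting time is at least 1.\<close>
  have R: "\<exists>i\<in>{1..Suc N}. n + i \<in> R" for n
  proof -
    obtain i where i: "i \<le> N" "(f ^^ i) ((f ^^ Suc n) a) \<in> V1" using N by blast
    have "(f ^^ (n + Suc i)) a = (f ^^ i) ((f ^^ Suc n) a)"
      by (metis add.commute add_Suc_shift comp_apply funpow_add)
    with i show ?thesis by (intro bexI[of _ "Suc i"]) (auto simp: R_def)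
  qed
  have hit: "\<exists>n>0. (skew_product f T (cocycle f ht) ^^ n) ` U \<inter> V \<noteq> {}"
    if "n \<in> R" "n > 0" "x \<in> U2" "int_iterate T (s n) x \<in> V2" for n x
  proof -
    have "(skew_product f T (cocycle f ht) ^^ n) (a, x) \<in> V" "(a, x) \<in> U"
      using that U(5) V(5) a by (auto simp: skew_product_funpow[OF T(1)] s_def R_def)
    with that(2) show ?thesis by blast
  qed
  have "\<exists>n. \<bar>s n\<bar> > M" for M
    unfolding s_def using birkhoff_sum_unbounded[OF assms(1,2,4)] assms(6) by blast
  then have "(\<forall>k. \<exists>n. s n \<ge> k) \<or> (\<forall>k. \<exists>n. - s n \<ge> k)"
    by (smt (verit, best))
  then show "\<exists>n>0. (skew_product f T (cocycle f ht) ^^ n) ` U \<inter> V \<noteq> {}"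
  proof
    assume "\<forall>k. \<exists>n. s n \<ge> k"
    then obtain M where M: "\<And>m::nat. \<exists>n\<in>R. n > 0 \<and> (\<exists>j\<le>M. s n = int (m + j))"
      using bounded_steps_meet_intervals[of s C "Suc N" R] step(1) R by (auto simp: s_def)
    obtain m where m: "\<And>j. j \<le> M \<Longrightarrow> \<exists>x\<in>U2. (T ^^ (m + j)) x \<in> V2"
      using weakly_mixing_thick[OF assms(5) T(2,3) U(3,4) V(3,4)] by blast
    obtain n j where n: "n \<in> R" "n > 0" "j \<le> M" "s n = int (m + j)" using M by blast
    obtain x where "x \<in> U2" "(T ^^ (m + j)) x \<in> V2" using m n(3) by blast
    then show ?thesis
      using hit[OF n(1,2)] n(4) by (simp add: int_iterate_def nat_int_add)
  next
    assume "\<forall>k. \<exists>n. - s n \<ge> k"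
    then obtain M where M: "\<And>m::nat. \<exists>n\<in>R. n > 0 \<and> (\<exists>j\<le>M. - s n = int (m + j))"
      using bounded_steps_meet_intervals[of "\<lambda>n. - s n" C "Suc N" R] step(2) R
      by (auto simp: s_def)
    \<comment> \<open>For negative sums the roles are exchanged: \<open>T\<close> carries
      \<open>y\<close> from \<open>V2\<close> into \<open>U2\<close>, and the power
      \<open>s n = - (m + j)\<close> brings that image back to \<open>y\<close>.\<close>
    obtain m where m: "\<And>j. j \<le> M \<Longrightarrow> \<exists>y\<in>V2. (T ^^ (m + j)) y \<in> U2"
      using weakly_mixing_thick[OF assms(5) T(2,3) V(3,4) U(3,4)] by blast
    obtain n j where n: "n \<in> R" "n > 0" "j \<le> M" "- s n = int (m + j)" using M by blast
    obtain y where y: "y \<in> V2" "(T ^^ (m + j)) y \<in> U2" using m n(3) by blast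
    have "int_iterate T (s n) ((T ^^ (m + j)) y) = y"
      using int_iterate_funpow_add[OF T(1), of "m + j" "s n" y] n(4) by simp
    with y show ?thesis using hit[OF n(1,2) y(2)] by simp
  qed
qed

end
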